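(* Let $k\ge1$ be an integer and let $\{\Gamma_n\}_{n\ge1}$ be a covering sequence of finite connected $2k$-regular graphs, i.e. for each $n\ge1$ there is a graph covering $\pi_{n+1}:\Gamma_{n+1}\to\Gamma_n$. Then there exist a rooted tree $T$ and a group $G$ of automorphisms of $T$ such that the $\Gamma_n$'s can be realized as the Schreier graphs, with respect to an appropriate finite set of generators of $G$, of the action of $G$ on $T$; that is, for each $n\ge1$, $\Gamma_n$ is isomorphic (as an unlabeled graph) to the Schreier graph of the action of $G$ on the $n$-th level of $T$.
   Context: Graphs may have loops and multiple edges; a loop contributes 2 to the degree. The $n$-th level of a rooted tree is the set of vertices at distance $n$ from the root; automorphisms fix the root and hence preserve the levels. For a group $G$ generated by $\sigma_1,\dots,\sigma_k$ acting on a set $M$, the Schreier graph of the action with respect to these generators is the graph with vertex set $M$ and, for each $m\in M$ and each $i\in\{1,\dots,k\}$, one edge between $m$ and $\sigma_i(m)$ (labeled by $\sigma_i$ and oriented from $m$ to $\sigma_i(m)$, the inverse edge being labeled $\sigma_i^{-1}$; labels and orientations are forgotten when comparing with $\Gamma_n$). *)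

theory Defs
  imports
    "Graph_Theory.Pair_Digraph"
    "Graph_Theory.Digraph_Component"
    "Graph_Theory.Shortest_Path"
    "HOL-Algebra.Generated_Groups"
    "HOL-Algebra.Group_Action"
begin

section \<open>Undirected multigraphs, coverings and isomorphisms\<close>

text \<open>
  An undirected graph with loops and multiple edges is a locale instance
  \<^term>\<open>bidirected_digraph G \<rho>\<close>: every undirected edge, loops included, is a pair of
  distinct arcs exchanged by \<open>\<rho>\<close> (Serre's formalism). Hence \<^term>\<open>out_degree G v\<close> is
  the degree of \<open>v\<close>, with a loop contributing 2. The locale normalises \<open>\<rho>\<close> to be the
  identity outside \<^term>\<open>arcs G\<close>.
\<close>

definition regular_multigraph :: "nat \<Rightarrow> ('a, 'b) pre_digraph \<Rightarrow> bool" where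
  "regular_multigraph d G \<longleftrightarrow> (\<forall>v \<in> verts G. out_degree G v = d)"

definition finite_connected_multigraph :: "('a, 'b) pre_digraph \<Rightarrow> ('b \<Rightarrow> 'b) \<Rightarrow> bool" where
  "finite_connected_multigraph G \<rho> \<longleftrightarrow>
     bidirected_digraph G \<rho> \<and> fin_digraph G \<and> Digraph_Component.connected G"

definition multigraph_hom ::
  "('a, 'b) pre_digraph \<Rightarrow> ('b \<Rightarrow> 'b) \<Rightarrow> ('c, 'd) pre_digraph \<Rightarrow> ('d \<Rightarrow> 'd)
    \<Rightarrow> ('a \<Rightarrow> 'c) \<Rightarrow> ('b \<Rightarrow> 'd) \<Rightarrow> bool" where
  "multigraph_hom G \<rho> H \<rho>' f g \<longleftrightarrow>
     (\<forall>v \<in> verts G. f v \<in> verts H) \<and>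
     (\<forall>a \<in> arcs G. g a \<in> arcs H \<and> tail H (g a) = f (tail G a) \<and>
        head H (g a) = f (head G a) \<and> g (\<rho> a) = \<rho>' (g a))"

text \<open>
  A covering is a surjective morphism that is a bijection on the star of each vertex. Stars
  consist of arcs, so the two ends of a loop are distinguished, as for topological coverings.
\<close>

definition multigraph_covering ::
  "('a, 'b) pre_digraph \<Rightarrow> ('b \<Rightarrow> 'b) \<Rightarrow> ('c, 'd) pre_digraph \<Rightarrow> ('d \<Rightarrow> 'd)
    \<Rightarrow> ('a \<Rightarrow> 'c) \<Rightarrow> ('b \<Rightarrow> 'd) \<Rightarrow> bool" where
  "multigraph_covering G \<rho> H \<rho>' f g \<longleftrightarrow>
     multigraph_hom G \<rho> H \<rho>' f g \<and> f ` verts G = verts H \<and>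
     (\<forall>v \<in> verts G. bij_betw g (out_arcs G v) (out_arcs H (f v)))"

definition multigraph_isomorphic ::
  "('a, 'b) pre_digraph \<Rightarrow> ('b \<Rightarrow> 'b) \<Rightarrow> ('c, 'd) pre_digraph \<Rightarrow> ('d \<Rightarrow> 'd) \<Rightarrow> bool" where
  "multigraph_isomorphic G \<rho> H \<rho>' \<longleftrightarrow>
     (\<exists>f g. multigraph_hom G \<rho> H \<rho>' f g \<and>
        bij_betw f (verts G) (verts H) \<and> bij_betw g (arcs G) (arcs H))"


section \<open>Rooted trees and their automorphisms\<close>

text \<open>
  Trees are connected simple graphs without cycles. The library's \<^const>\<open>tree\<close> forbids only
  directed cycles and does not apply: in a symmetric digraph each edge traversed back and
  forth is a \<open>cycle\<close> of length 2. With loops and multiple edges excluded, the cycles of the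
  undirected graph are those of length at least 3.
\<close>

locale rooted_tree = pair_bidirected_digraph T
  for T :: "'a pair_pre_digraph" +
  fixes r :: 'a
  assumes root_in_verts: "r \<in> pverts T"
    and connected_tree: "Digraph_Component.connected (with_proj T)"
    and acyclic_tree: "\<not> (\<exists>p. pre_digraph.cycle (with_proj T) p \<and> 3 \<le> length p)"

text \<open>With all weights 1, \<^const>\<open>wf_digraph.\<mu>\<close> is the graph distance.\<close>

definition tree_level :: "'a pair_pre_digraph \<Rightarrow> 'a \<Rightarrow> nat \<Rightarrow> 'a set" where
  "tree_level T r n =
     {v \<in> pverts T. wf_digraph.\<mu> (with_proj T) (\<lambda>_. 1) r v = ereal (real n)}"

definition tree_Aut :: "'a pair_pre_digraph \<Rightarrow> 'a \<Rightarrow> ('a \<Rightarrow> 'a) monoid" where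
  "tree_Aut T r = BijGroup (pverts T)
     \<lparr>carrier := {f \<in> Bij (pverts T). f r = r \<and>
        (\<forall>u \<in> pverts T. \<forall>v \<in> pverts T. (f u, f v) \<in> parcs T \<longleftrightarrow> (u, v) \<in> parcs T)}\<rparr>"

definition level_action ::
  "'a pair_pre_digraph \<Rightarrow> 'a \<Rightarrow> nat \<Rightarrow> ('a \<Rightarrow> 'a) \<Rightarrow> 'a \<Rightarrow> 'a" where
  "level_action T r n = (\<lambda>f. restrict f (tree_level T r n))"


section \<open>Schreier graphs\<close>

text \<open>
  Generators form a list, since repeated generators and generators fixing a point contribute
  separate edges. The edge from \<open>m\<close> to \<open>\<phi> (gs ! i) m\<close> consists of the arc \<open>(m, i, True)\<close>
  in this direction and its reverse \<open>(m, i, False)\<close>.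
\<close>

definition schreier_graph ::
  "('g \<Rightarrow> 'a \<Rightarrow> 'a) \<Rightarrow> 'a set \<Rightarrow> 'g list \<Rightarrow> ('a, 'a \<times> nat \<times> bool) pre_digraph" where
  "schreier_graph \<phi> M gs =
     \<lparr>verts = M, arcs = M \<times> {..<length gs} \<times> UNIV,
      tail = (\<lambda>(m, i, b). if b then m else \<phi> (gs ! i) m),
      head = (\<lambda>(m, i, b). if b then \<phi> (gs ! i) m else m)\<rparr>"

definition schreier_rev ::
  "'a set \<Rightarrow> 'g list \<Rightarrow> 'a \<times> nat \<times> bool \<Rightarrow> 'a \<times> nat \<times> bool" where
  "schreier_rev M gs =
     (\<lambda>(m, i, b). if m \<in> M \<and> i < length gs then (m, i, \<not> b) else (m, i, b))"


section \<open>Basic facts\<close>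

lemma bidirected_schreier_graph:
  assumes "\<And>g m. g \<in> set gs \<Longrightarrow> m \<in> M \<Longrightarrow> \<phi> g m \<in> M"
  shows "bidirected_digraph (schreier_graph \<phi> M gs) (schreier_rev M gs)"
  using assms
  by unfold_locales (auto simp: schreier_graph_def schreier_rev_def split: if_splits)

lemma subgroup_tree_Aut:
  assumes "r \<in> pverts T"
  shows "subgroup (carrier (tree_Aut T r)) (BijGroup (pverts T))"
proof -
  interpret B: group "BijGroup (pverts T)" by (rule group_BijGroup)
  show ?thesis
  proof (rule B.subgroupI)
    show "carrier (tree_Aut T r) \<subseteq> carrier (BijGroup (pverts T))"
      by (auto simp: tree_Aut_def BijGroup_def)
    have "(\<lambda>x\<in>pverts T. x) \<in> carrier (tree_Aut T r)"
      using assms by (auto simp: tree_Aut_def id_Bij)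
    then show "carrier (tree_Aut T r) \<noteq> {}" by auto
  next
    fix f assume f: "f \<in> carrier (tree_Aut T r)"
    then have fB: "f \<in> Bij (pverts T)" and fr: "f r = r"
      and fe: "\<And>u v. u \<in> pverts T \<Longrightarrow> v \<in> pverts T \<Longrightarrow>
                 (f u, f v) \<in> parcs T \<longleftrightarrow> (u, v) \<in> parcs T"
      by (auto simp: tree_Aut_def)
    let ?g = "inv_into (pverts T) f"
    have im: "f ` pverts T = pverts T" and inj: "inj_on f (pverts T)"
      using fB by (auto simp: Bij_def bij_betw_def)
    have g: "?g u \<in> pverts T" "f (?g u) = u" if "u \<in> pverts T" for u
      using that im by (auto intro: inv_into_into f_inv_into_f)
    have "?g r = r" using inv_into_f_f[OF inj assms] fr by simp
    moreover have "(?g u, ?g v) \<in> parcs T \<longleftrightarrow> (u, v) \<in> parcs T"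
      if "u \<in> pverts T" "v \<in> pverts T" for u v
      using fe[OF g(1)[OF that(1)] g(1)[OF that(2)]] g(2) that by simp
    ultimately have "restrict ?g (pverts T) \<in> carrier (tree_Aut T r)"
      using assms restrict_inv_into_Bij[OF fB] by (auto simp: tree_Aut_def)
    then show "inv\<^bsub>BijGroup (pverts T)\<^esub> f \<in> carrier (tree_Aut T r)"
      by (simp add: inv_BijGroup[OF fB])
  next
    fix f g assume "f \<in> carrier (tree_Aut T r)" "g \<in> carrier (tree_Aut T r)"
    then show "f \<otimes>\<^bsub>BijGroup (pverts T)\<^esub> g \<in> carrier (tree_Aut T r)"
      using assms Bij_imp_funcset[of g "pverts T"]
      by (auto simp: tree_Aut_def BijGroup_def compose_Bij compose_eq Pi_iff)
  qed
qed

lemma group_tree_Aut: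
  assumes "r \<in> pverts T"
  shows "group (tree_Aut T r)"
  using group.subgroup_imp_group[OF group_BijGroup subgroup_tree_Aut[OF assms]]
  by (simp add: tree_Aut_def)

lemma tree_Aut_awalk:
  assumes "f \<in> carrier (tree_Aut T r)" and "pair_wf_digraph T"
    and "pre_digraph.awalk (with_proj T) u p v"
  shows "pre_digraph.awalk (with_proj T) (f u) (map (map_prod f f) p) (f v)"
proof -
  interpret pair_wf_digraph T by fact
  have fV: "f w \<in> pverts T" if "w \<in> pverts T" for w
    using assms(1) that Bij_imp_funcset by (fastforce simp: tree_Aut_def)
  have fE: "(f x, f y) \<in> parcs T" if "(x, y) \<in> parcs T" for x y
    using assms(1) that in_arcsD1[OF that] in_arcsD2[OF that] by (auto simp: tree_Aut_def)
  show ?thesis using assms(3)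
  proof (induction p arbitrary: u)
    case Nil
    then show ?case using fV by (auto simp: awalk_Nil_iff)
  next
    case (Cons a p)
    then show ?case using fV fE by (cases a) (auto simp: awalk_Cons_iff)
  qed
qed

lemma tree_Aut_distance_le:
  assumes "f \<in> carrier (tree_Aut T r)" and "pair_wf_digraph T"
  shows "wf_digraph.\<mu> (with_proj T) (\<lambda>_. 1) r (f v) \<le> wf_digraph.\<mu> (with_proj T) (\<lambda>_. 1) r v"
proof -
  interpret pair_wf_digraph T by fact
  have fr: "f r = r" using assms(1) by (simp add: tree_Aut_def)
  show ?thesis
    unfolding \<mu>_def
  proof (rule INF_mono)
    fix p assume "p \<in> {p. awalk r p v}"
    then have "awalk r (map (map_prod f f) p) (f v)"
      using tree_Aut_awalk[OF assms, of r p v] fr by simp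
    then show "\<exists>q\<in>{q. awalk r q (f v)}. ereal (awalk_cost (\<lambda>_. 1) q)
                 \<le> ereal (awalk_cost (\<lambda>_. 1) p)"
      by (intro bexI[of _ "map (map_prod f f) p"]) (auto simp: awalk_cost_def comp_def)
  qed
qed

lemma group_action_level_action:
  assumes "rooted_tree T r" and "subgroup G (tree_Aut T r)"
  shows "group_action (tree_Aut T r\<lparr>carrier := G\<rparr>) (tree_level T r n) (level_action T r n)"
proof -
  interpret rooted_tree T r by fact
  interpret A: group "tree_Aut T r" by (rule group_tree_Aut[OF root_in_verts])
  let ?L = "tree_level T r n"
  have wf: "pair_wf_digraph T" by unfold_locales
  have LV: "?L \<subseteq> pverts T" by (auto simp: tree_level_def)
  have bij: "bij_betw f ?L ?L" if f: "f \<in> carrier (tree_Aut T r)" for f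
  proof -
    have fB: "f \<in> Bij (pverts T)" using f by (simp add: tree_Aut_def)
    let ?h = "inv\<^bsub>tree_Aut T r\<^esub> f"
    have h: "?h \<in> carrier (tree_Aut T r)" using f by simp
    have hB: "?h \<in> Bij (pverts T)" using h by (simp add: tree_Aut_def)
    have fh: "f (?h v) = v" if "v \<in> pverts T" for v
    proof -
      have "compose (pverts T) f ?h = (\<lambda>x\<in>pverts T. x)"
        using A.r_inv[OF f] fB hB by (simp add: tree_Aut_def BijGroup_def)
      from fun_cong[OF this, of v] show ?thesis using that by (simp add: compose_eq)
    qed
    have mem: "g v \<in> ?L" if "g \<in> carrier (tree_Aut T r)" "v \<in> ?L" for g v
    proof -
      let ?i = "inv\<^bsub>tree_Aut T r\<^esub> g"
      have i: "?i \<in> carrier (tree_Aut T r)" using that by simp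
      have gB: "g \<in> Bij (pverts T)" and iB: "?i \<in> Bij (pverts T)"
        using that(1) i by (simp_all add: tree_Aut_def)
      have v: "v \<in> pverts T" using that LV by auto
      have "compose (pverts T) ?i g = (\<lambda>x\<in>pverts T. x)"
        using A.l_inv[OF that(1)] gB iB by (simp add: tree_Aut_def BijGroup_def)
      from fun_cong[OF this, of v] have "?i (g v) = v" using v by (simp add: compose_eq)
      then have "wf_digraph.\<mu> (with_proj T) (\<lambda>_. 1) r (g v) = wf_digraph.\<mu> (with_proj T) (\<lambda>_. 1) r v"
        using tree_Aut_distance_le[OF that(1) wf, of v] tree_Aut_distance_le[OF i wf, of "g v"]
        by simp
      moreover have "g v \<in> pverts T" using Bij_imp_funcset[OF gB] v by auto
      ultimately show ?thesis using that(2) by (simp add: tree_level_def)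
    qed
    have "inj_on f ?L" using fB LV by (auto simp: Bij_def bij_betw_def intro: inj_on_subset)
    moreover have "f ` ?L = ?L"
    proof
      show "f ` ?L \<subseteq> ?L" using mem[OF f] by auto
      show "?L \<subseteq> f ` ?L"
      proof
        fix v assume v: "v \<in> ?L"
        have "f (?h v) = v" using fh v LV by blast
        then show "v \<in> f ` ?L" using mem[OF h v] by (rule image_eqI[OF sym])
      qed
    qed
    ultimately show ?thesis by (simp add: bij_betw_def)
  qed
  have GA: "G \<subseteq> carrier (tree_Aut T r)" using assms(2) by (rule subgroup.subset)
  have LB: "level_action T r n f \<in> Bij ?L" if "f \<in> G" for f
    using bij[of f] that GA by (auto simp: level_action_def Bij_def bij_betw_def inj_on_def)
  show ?thesis
    unfolding group_action_def group_hom_def group_hom_axioms_def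
  proof (intro conjI)
    show "group (tree_Aut T r\<lparr>carrier := G\<rparr>)"
      by (rule A.subgroup_imp_group[OF assms(2)])
    show "group (BijGroup ?L)" by (rule group_BijGroup)
    show "level_action T r n \<in> hom (tree_Aut T r\<lparr>carrier := G\<rparr>) (BijGroup ?L)"
    proof (rule homI)
      fix f assume "f \<in> carrier (tree_Aut T r\<lparr>carrier := G\<rparr>)"
      then show "level_action T r n f \<in> carrier (BijGroup ?L)"
        using LB by (simp add: BijGroup_def)
    next
      fix f g assume "f \<in> carrier (tree_Aut T r\<lparr>carrier := G\<rparr>)" "g \<in> carrier (tree_Aut T r\<lparr>carrier := G\<rparr>)"
      then have f: "f \<in> G" and g: "g \<in> G" by auto
      have "f \<in> Bij (pverts T)" "g \<in> Bij (pverts T)"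
        using f g GA by (auto simp: tree_Aut_def)
      then have "f \<otimes>\<^bsub>tree_Aut T r\<lparr>carrier := G\<rparr>\<^esub> g = compose (pverts T) f g"
        by (simp add: tree_Aut_def BijGroup_def)
      moreover have "level_action T r n f \<otimes>\<^bsub>BijGroup ?L\<^esub> level_action T r n g
          = compose ?L (level_action T r n f) (level_action T r n g)"
        using LB f g by (simp add: BijGroup_def)
      moreover have "g v \<in> ?L" if "v \<in> ?L" for v
        using bij[of g] g GA that by (auto simp: bij_betw_def)
      ultimately show "level_action T r n (f \<otimes>\<^bsub>tree_Aut T r\<lparr>carrier := G\<rparr>\<^esub> g)
          = level_action T r n f \<otimes>\<^bsub>BijGroup ?L\<^esub> level_action T r n g"
        using LV by (intro ext) (simp add: level_action_def compose_def subset_iff)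
    qed
  qed
qed

end

theory Submission
  imports Defs
begin

text \<open>
  A \<open>2 * k\<close>-regular graph is a Schreier graph as soon as its edges can be oriented and
  labelled by \<open>1, \<dots>, k\<close> such that every vertex has one outgoing and one incoming edge of
  each label, for then each label is a permutation of the vertices. Petersen's 2-factor
  theorem provides such a labelling of \<open>\<Gamma> 1\<close> (\<open>ex_schreier_labelling\<close>). Coverings are
  bijective on stars, so the labelling pulls back step by step to all \<open>\<Gamma> n\<close>
  (\<open>schreier_labelling_lift\<close>), and the resulting permutations commute with the covering maps
  (\<open>follow_covering\<close>).

  The tree has the vertices of \<open>\<Gamma> n\<close> as its \<open>n\<close>-th level below an additional root; the parent
  of a vertex is its image under the covering, and all vertices of \<open>\<Gamma> 1\<close> are children of the
  root. The permutations belonging to one label on all levels combine to an automorphism of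
  this tree (\<open>tree_map_in_Aut\<close>). These \<open>k\<close> automorphisms generate the required group: on the
  \<open>n\<close>-th level they act by the permutations read off from \<open>\<Gamma> n\<close>, whose Schreier graph is
  \<open>\<Gamma> n\<close> by construction (\<open>isomorphic_schreier_graph\<close>).

  The two classical ingredients of Petersen's theorem, a balanced orientation and the
  factorization of a regular bipartite multigraph into perfect matchings, are both derived
  from one lemma: the edge set of a bipartite multigraph with even degrees splits into two
  parts, each having half of the degree at every vertex (\<open>split_even_degrees\<close>). An
  orientation is a single such splitting, and perfect matchings arise by repeating it
  (\<open>regular_bipartite_perfect_matching\<close>).
\<close>

section \<open>Halving a bipartite multigraph of even degrees\<close>

text \<open>
  A family of edges \<open>E\<close> with two endpoint maps \<open>s\<close> and \<open>t\<close> is read as a bipartite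
  multigraph whose two sides are the targets of \<open>s\<close> and \<open>t\<close>; \<open>deg E s x\<close> is then a
  degree. Taking \<open>s\<close> and \<open>t\<close> to be the tail and head maps turns directed 2-factors of a
  digraph into perfect matchings.
\<close>

abbreviation deg :: "'e set \<Rightarrow> ('e \<Rightarrow> 'x) \<Rightarrow> 'x \<Rightarrow> nat" where
  "deg E s x \<equiv> card {e \<in> E. s e = x}"

definition pairing_on :: "'a set \<Rightarrow> ('a \<Rightarrow> 'a) \<Rightarrow> bool" where
  "pairing_on A \<tau> \<longleftrightarrow> (\<forall>a \<in> A. \<tau> a \<in> A \<and> \<tau> a \<noteq> a \<and> \<tau> (\<tau> a) = a)"

lemma pairing_onD:
  assumes "pairing_on A \<tau>" "a \<in> A"
  shows "\<tau> a \<in> A" "\<tau> a \<noteq> a" "\<tau> (\<tau> a) = a"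
  using assms by (simp_all add: pairing_on_def)

lemma ex_pairing_on_even:
  assumes "finite A" "even (card A)"
  shows "\<exists>\<tau>. pairing_on A \<tau>"
  using assms
proof (induction "card A" arbitrary: A rule: less_induct)
  case less
  show ?case
  proof (cases "A = {}")
    case True
    then show ?thesis by (auto simp: pairing_on_def)
  next
    case False
    then obtain a where a: "a \<in> A" by blast
    have "card (A - {a}) = card A - 1" "card A \<noteq> 0"
      using less.prems a by auto
    moreover have "card A \<noteq> 1" using less.prems(2) by auto
    ultimately have "card (A - {a}) \<noteq> 0" by simp
    then have "A - {a} \<noteq> {}" by (metis card.empty)
    then obtain b where b: "b \<in> A" "b \<noteq> a" by blast
    have ab: "card (A - {a, b}) = card A - 2"
      using a b less.prems by (subst card_Diff_subset) auto
    have "card A \<ge> 2"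
      using card_mono[of A "{a, b}"] a b less.prems by auto
    then have "card (A - {a, b}) < card A" "even (card (A - {a, b}))"
      using ab less.prems(2) by auto
    then obtain \<tau> where "pairing_on (A - {a, b}) \<tau>"
      using less.hyps less.prems(1) by blast
    then have "pairing_on A (\<tau>(a := b, b := a))"
      using a b unfolding pairing_on_def by auto
    then show ?thesis by blast
  qed
qed

lemma ex_fibrewise_pairing:
  assumes "finite E" "\<And>x. even (deg E s x)"
  shows "\<exists>\<tau>. pairing_on E \<tau> \<and> (\<forall>e \<in> E. s (\<tau> e) = s e)"
proof -
  have "\<forall>x. \<exists>\<tau>. pairing_on {e \<in> E. s e = x} \<tau>"
    using assms by (auto intro: ex_pairing_on_even)
  then obtain \<tau> where "\<And>x. pairing_on {e \<in> E. s e = x} (\<tau> x)" by metis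
  then show ?thesis
    by (intro exI[of _ "\<lambda>e. \<tau> (s e) e"]) (auto simp: pairing_on_def)
qed

text \<open>
  Following \<open>\<rho>\<close> and \<open>\<tau>\<close> alternately runs through cycles of even length, which can be
  2-coloured. The induction avoids speaking of cycles: it cuts out a pair \<open>a\<close>, \<open>\<tau> a\<close> and
  splices the two dangling \<open>\<rho>\<close>-partners together.
\<close>

lemma pairings_common_2_colouring:
  assumes "finite A" "pairing_on A \<rho>" "pairing_on A \<tau>"
  shows "\<exists>P \<subseteq> A. \<forall>a \<in> A. (\<rho> a \<in> P \<longleftrightarrow> a \<notin> P) \<and> (\<tau> a \<in> P \<longleftrightarrow> a \<notin> P)"
  using assms
proof (induction "card A" arbitrary: A \<rho> \<tau> rule: less_induct)
  case less
  show ?case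
  proof (cases "A = {}")
    case True
    then show ?thesis by auto
  next
    case False
    then obtain a where a: "a \<in> A" by blast
    define b where "b = \<tau> a"
    have b: "b \<in> A" "b \<noteq> a" "\<tau> b = a" "\<tau> a = b"
      using pairing_onD[OF less.prems(3) a] by (simp_all add: b_def)
    let ?B = "A - {a, b}"
    have "?B \<subset> A" using a by blast
    then have B: "card ?B < card A" "finite ?B"
      using less.prems(1) psubset_card_mono[of A ?B] by simp_all
    note \<tau>D = pairing_onD[OF less.prems(3)]
    have \<tau>_other: "\<tau> x \<in> ?B" if "x \<in> ?B" for x
    proof -
      have "\<tau> x \<noteq> a" "\<tau> x \<noteq> b" using \<tau>D(3)[of x] b that by auto
      then show ?thesis using \<tau>D(1)[of x] that by simp
    qed
    then have \<tau>: "pairing_on ?B \<tau>" using \<tau>D by (simp add: pairing_on_def)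
    note \<rho>D = pairing_onD[OF less.prems(2)]
    show ?thesis
    proof (cases "\<rho> a = b")
      case True
      then have \<rho>b: "\<rho> b = a" using \<rho>D(3)[OF a] by simp
      have \<rho>_other: "\<rho> x \<in> ?B" if "x \<in> ?B" for x
      proof -
        have "\<rho> x \<noteq> a" "\<rho> x \<noteq> b" using \<rho>D(3)[of x] True \<rho>b that by auto
        then show ?thesis using \<rho>D(1)[of x] that by simp
      qed
      then have "pairing_on ?B \<rho>" using \<rho>D by (simp add: pairing_on_def)
      from less.hyps[OF B this \<tau>] obtain P where P: "P \<subseteq> ?B"
        "\<forall>x \<in> ?B. (\<rho> x \<in> P \<longleftrightarrow> x \<notin> P) \<and> (\<tau> x \<in> P \<longleftrightarrow> x \<notin> P)"
        by (elim exE conjE)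
      note PD = P(2)[rule_format]
      have "(\<rho> x \<in> insert a P \<longleftrightarrow> x \<notin> insert a P) \<and> (\<tau> x \<in> insert a P \<longleftrightarrow> x \<notin> insert a P)"
        if "x \<in> A" for x
      proof (cases "x \<in> {a, b}")
        case True
        then show ?thesis using b P(1) \<rho>b \<open>\<rho> a = b\<close> by auto
      next
        case False
        then have x: "x \<in> ?B" using that by simp
        then show ?thesis using PD[OF x] \<rho>_other[OF x] \<tau>_other[OF x] by auto
      qed
      then show ?thesis using P(1) a by (intro exI[of _ "insert a P"]) auto
    next
      case False
      define c d where "c = \<rho> a" and "d = \<rho> b"
      have cd': "\<rho> c = a" "\<rho> d = b" "c \<in> A" "d \<in> A"
        using \<rho>D a b(1) by (simp_all add: c_def d_def)
      have "c \<noteq> a" "c \<noteq> b" "d \<noteq> b" "c \<noteq> d"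
        using False \<rho>D(2)[OF a] \<rho>D(2)[OF b(1)] cd' b(2) by (auto simp: c_def d_def)
      moreover have "d \<noteq> a" using cd'(2) False by auto
      ultimately have cd: "c \<in> ?B" "d \<in> ?B" "c \<noteq> d" "\<rho> c = a" "\<rho> d = b"
        using cd' by simp_all
      define \<rho>' where "\<rho>' = \<rho>(c := d, d := c)"
      have other: "\<rho> x \<in> ?B - {c, d}" if "x \<in> ?B - {c, d}" for x
      proof -
        have neq: "\<rho> x \<noteq> y" if "\<rho> y \<noteq> x" for y
          using that \<rho>D(3)[of x] \<open>x \<in> ?B - {c, d}\<close> by auto
        have "\<rho> x \<noteq> a" "\<rho> x \<noteq> b" "\<rho> x \<noteq> c" "\<rho> x \<noteq> d"
          using that cd(4,5) c_def d_def by (auto intro!: neq)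
        then show ?thesis using that \<rho>D(1)[of x] by simp
      qed
      have "pairing_on ?B \<rho>'"
        unfolding pairing_on_def
      proof
        fix x assume x: "x \<in> ?B"
        show "\<rho>' x \<in> ?B \<and> \<rho>' x \<noteq> x \<and> \<rho>' (\<rho>' x) = x"
        proof (cases "x \<in> {c, d}")
          case True
          then show ?thesis using cd by (auto simp: \<rho>'_def)
        next
          case False
          then have "x \<in> ?B - {c, d}" using x by simp
          then show ?thesis using other[of x] x \<rho>D(2,3)[of x] by (simp add: \<rho>'_def)
        qed
      qed
      from less.hyps[OF B this \<tau>] obtain P where P: "P \<subseteq> ?B"
        "\<forall>x \<in> ?B. (\<rho>' x \<in> P \<longleftrightarrow> x \<notin> P) \<and> (\<tau> x \<in> P \<longleftrightarrow> x \<notin> P)"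
        by (elim exE conjE)
      note PD = P(2)[rule_format]
      have dc: "d \<in> P \<longleftrightarrow> c \<notin> P" using PD[OF cd(1)] cd(3) by (simp add: \<rho>'_def)
      define e where "e = (if c \<in> P then b else a)"
      have "(\<rho> x \<in> insert e P \<longleftrightarrow> x \<notin> insert e P) \<and> (\<tau> x \<in> insert e P \<longleftrightarrow> x \<notin> insert e P)"
        if x: "x \<in> A" for x
      proof -
        have notP: "a \<notin> P" "b \<notin> P" using P(1) by auto
        have rab: "\<rho> a = c" "\<rho> b = d" by (simp_all add: c_def d_def)
        have ne: "c \<noteq> a" "c \<noteq> b" "d \<noteq> a" "d \<noteq> b" "a \<noteq> b" using cd b(2) by auto
        consider "x = a" | "x = b" | "x = c" | "x = d" | "x \<in> ?B - {c, d}" using x by blast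
        then show ?thesis
        proof cases
          case 1
          show ?thesis unfolding 1 using notP rab ne dc b(4) by (simp add: e_def)
        next
          case 2
          show ?thesis unfolding 2 using notP rab ne dc b(3) by (simp add: e_def)
        next
          case 3
          show ?thesis unfolding 3
            using notP ne dc cd(4) PD[OF cd(1)] \<tau>_other[OF cd(1)] by (simp add: e_def)
        next
          case 4
          show ?thesis unfolding 4
            using notP ne dc cd(5) PD[OF cd(2)] \<tau>_other[OF cd(2)] by (simp add: e_def)
        next
          case 5
          then have "x \<in> ?B" by simp
          then show ?thesis
            using 5 PD[of x] \<tau>_other[of x] other[of x] by (simp add: e_def \<rho>'_def)
        qed
      qed
      then show ?thesis using P(1) a b by (intro exI[of _ "insert e P"]) (auto simp: e_def)
    qed
  qed
qed

lemma card_Collect_split: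
  assumes "finite E" "P \<subseteq> E"
  shows "card {e \<in> E. R e} = card {e \<in> P. R e} + card {e \<in> E - P. R e}"
proof -
  have "{e \<in> E. R e} = {e \<in> P. R e} \<union> {e \<in> E - P. R e}" using assms(2) by auto
  moreover have "finite P" using assms finite_subset by auto
  moreover have "{e \<in> P. R e} \<inter> {e \<in> E - P. R e} = {}" by auto
  ultimately show ?thesis using assms(1) by (simp add: card_Un_disjoint)
qed

lemma deg_halved_by_colouring:
  assumes "finite E" "P \<subseteq> E" "pairing_on E \<tau>"
    and s: "\<And>e. e \<in> E \<Longrightarrow> s (\<tau> e) = s e"
    and P: "\<And>e. e \<in> E \<Longrightarrow> \<tau> e \<in> P \<longleftrightarrow> e \<notin> P"
  shows "deg E s x = 2 * deg P s x"
proof -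
  have "bij_betw \<tau> {e \<in> P. s e = x} {e \<in> E - P. s e = x}"
    using pairing_onD[OF assms(3)] s P assms(2)
    by (intro bij_betw_byWitness[where f' = \<tau>]) (fastforce simp: subset_iff)+
  then have "deg P s x = deg (E - P) s x" by (rule bij_betw_same_card)
  then show ?thesis using card_Collect_split[OF assms(1,2), of "\<lambda>e. s e = x"] by simp
qed

text \<open>
  Pair the edges at each left vertex and, independently, at each right vertex. A common
  2-colouring of the two pairings takes one edge from each pair, hence half of every star.
  On a cycle this is alternate colouring; in general it is Euler's argument that a graph with
  even degrees splits evenly.
\<close>

lemma split_even_degrees:
  assumes "finite E" "\<And>x. even (deg E s x)" "\<And>y. even (deg E t y)"
  shows "\<exists>P \<subseteq> E. (\<forall>x. deg E s x = 2 * deg P s x) \<and> (\<forall>y. deg E t y = 2 * deg P t y)"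
proof -
  obtain \<rho> where \<rho>: "pairing_on E \<rho>" "\<And>e. e \<in> E \<Longrightarrow> s (\<rho> e) = s e"
    using ex_fibrewise_pairing[of E s, OF assms(1,2)] by blast
  obtain \<tau> where \<tau>: "pairing_on E \<tau>" "\<And>e. e \<in> E \<Longrightarrow> t (\<tau> e) = t e"
    using ex_fibrewise_pairing[of E t, OF assms(1,3)] by blast
  obtain P where P: "P \<subseteq> E"
    "\<forall>e \<in> E. (\<rho> e \<in> P \<longleftrightarrow> e \<notin> P) \<and> (\<tau> e \<in> P \<longleftrightarrow> e \<notin> P)"
    using pairings_common_2_colouring[OF assms(1) \<rho>(1) \<tau>(1)] by (elim exE conjE)
  have "deg E s x = 2 * deg P s x" for x
    using \<rho>(2) P(2) by (intro deg_halved_by_colouring[OF assms(1) P(1) \<rho>(1)]) simp_all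
  moreover have "deg E t y = 2 * deg P t y" for y
    using \<tau>(2) P(2) by (intro deg_halved_by_colouring[OF assms(1) P(1) \<tau>(1)]) simp_all
  ultimately show ?thesis using P(1) by (intro exI[of _ P]) simp
qed

text \<open>
  Splitting \<open>n\<close> times divides all degrees by \<open>2 ^ n\<close>. Since one is free to keep either
  half, the number of edges in a prescribed set \<open>B\<close> can be made to drop by at least
  the same factor.
\<close>

lemma iterated_halving:
  assumes "finite F" "\<And>x. deg F s x = 2 ^ n * p x" "\<And>y. deg F t y = 2 ^ n * q y"
  shows "\<exists>P \<subseteq> F. (\<forall>x. deg P s x = p x) \<and> (\<forall>y. deg P t y = q y) \<and>
           2 ^ n * card (P \<inter> B) \<le> card (F \<inter> B)"
  using assms
proof (induction n arbitrary: F)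
  case 0
  then show ?case by (intro exI[of _ F]) simp
next
  case (Suc n)
  have "even (deg F s x)" "even (deg F t y)" for x y
    unfolding Suc.prems(2) Suc.prems(3) by simp_all
  from split_even_degrees[of F s t, OF Suc.prems(1) this]
  obtain P where P: "P \<subseteq> F" "\<And>x. deg F s x = 2 * deg P s x" "\<And>y. deg F t y = 2 * deg P t y"
    by blast
  have halves: "\<exists>Q \<subseteq> F. (\<forall>x. deg F s x = 2 * deg Q s x) \<and> (\<forall>y. deg F t y = 2 * deg Q t y) \<and>
      2 * card (Q \<inter> B) \<le> card (F \<inter> B)"
  proof (cases "2 * card (P \<inter> B) \<le> card (F \<inter> B)")
    case True
    then show ?thesis using P by blast
  next
    case False
    note compl = card_Collect_split[OF Suc.prems(1) P(1)]
    have "deg F s x = 2 * deg (F - P) s x" "deg F t y = 2 * deg (F - P) t y" for x y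
      using compl[of "\<lambda>e. s e = x"] compl[of "\<lambda>e. t e = y"] P(2)[of x] P(3)[of y] by simp_all
    moreover have "2 * card ((F - P) \<inter> B) \<le> card (F \<inter> B)"
      using False compl[of "\<lambda>e. e \<in> B"] by (simp add: Int_def)
    ultimately show ?thesis by (intro exI[of _ "F - P"]) simp
  qed
  then obtain Q where Q: "Q \<subseteq> F" "\<And>x. deg F s x = 2 * deg Q s x"
    "\<And>y. deg F t y = 2 * deg Q t y" "2 * card (Q \<inter> B) \<le> card (F \<inter> B)" by blast
  have "deg Q s x = 2 ^ n * p x" "deg Q t y = 2 ^ n * q y" for x y
    using Q(2)[of x] Q(3)[of y] Suc.prems(2)[of x] Suc.prems(3)[of y] by simp_all
  from Suc.IH[of Q, OF finite_subset[OF Q(1) Suc.prems(1)] this]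
  obtain P' where "P' \<subseteq> Q" "\<And>x. deg P' s x = p x" "\<And>y. deg P' t y = q y"
    "2 ^ n * card (P' \<inter> B) \<le> card (Q \<inter> B)"
    by blast
  moreover from this(4) Q(4) have "2 ^ Suc n * card (P' \<inter> B) \<le> card (F \<inter> B)" by simp
  ultimately show ?case using Q(1) by (intro exI[of _ P']) simp
qed

section \<open>Perfect matchings and 1-factorizations of regular bipartite multigraphs\<close>

text \<open>
  Alon's proof of the theorem of Koenig. Halving works directly only if \<open>k\<close> is a power of 2.
  In general, divide \<open>2 ^ n\<close> by \<open>k\<close> with quotient \<open>\<alpha>\<close> and remainder \<open>\<beta>\<close>; taking \<open>\<alpha>\<close> copies
  of every edge and \<open>\<beta>\<close> dummy edges joining the two copies of every vertex gives degree
  exactly \<open>2 ^ n\<close>. There are fewer than \<open>2 ^ n\<close> dummy edges once \<open>n\<close> is large, so halving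
  \<open>n\<close> times can be arranged to leave none of them, and what remains is a matching.
\<close>

lemma regular_bipartite_perfect_matching:
  assumes "finite E" "finite V" "k \<ge> 1"
    and s: "\<And>x. deg E s x = (if x \<in> V then k else 0)"
    and t: "\<And>y. deg E t y = (if y \<in> V then k else 0)"
  shows "\<exists>P \<subseteq> E. (\<forall>x. deg P s x = (if x \<in> V then 1 else 0)) \<and>
           (\<forall>y. deg P t y = (if y \<in> V then 1 else 0))"
proof -
  obtain n :: nat where n: "card V * k < 2 ^ n" using less_exp by blast
  define \<alpha> \<beta> where "\<alpha> = 2 ^ n div k" and "\<beta> = 2 ^ n mod k"
  have \<alpha>\<beta>: "\<alpha> * k + \<beta> = 2 ^ n" by (simp add: \<alpha>_def \<beta>_def)
  define F where "F = (E \<times> {..<\<alpha>}) <+> (V \<times> {..<\<beta>})"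
  define ext where "ext f = case_sum (\<lambda>(e, i::nat). f e) (\<lambda>(v, i::nat). v)" for f :: "'a \<Rightarrow> 'b"
  have finF: "finite F" using assms(1,2) by (simp add: F_def)
  have deg_ext: "deg F (ext f) x = 2 ^ n * (if x \<in> V then 1 else 0)"
    if f: "\<And>x. deg E f x = (if x \<in> V then k else 0)" for f x
  proof -
    have "{z \<in> F. ext f z = x} = ({e \<in> E. f e = x} \<times> {..<\<alpha>}) <+> ((V \<inter> {x}) \<times> {..<\<beta>})"
      by (auto simp: F_def ext_def)
    then have "deg F (ext f) x = deg E f x * \<alpha> + card (V \<inter> {x}) * \<beta>"
      using assms(1,2) by (simp add: card_Plus card_cartesian_product)
    then show ?thesis using f[of x] \<alpha>\<beta> by (simp add: mult.commute)
  qed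
  obtain P where P: "P \<subseteq> F" "\<And>x. deg P (ext s) x = (if x \<in> V then 1 else 0)"
    "\<And>x. deg P (ext t) x = (if x \<in> V then 1 else 0)"
    "2 ^ n * card (P \<inter> range Inr) \<le> card (F \<inter> range Inr)"
    using iterated_halving[of F "ext s" n _ "ext t", OF finF deg_ext[OF s] deg_ext[OF t], of "range Inr"] by blast
  have "F \<inter> range Inr = Inr ` (V \<times> {..<\<beta>})" by (auto simp: F_def)
  then have "card (F \<inter> range Inr) = card V * \<beta>"
    by (simp add: card_image card_cartesian_product)
  also have "\<dots> \<le> card V * k" using \<open>k \<ge> 1\<close> by (simp add: \<beta>_def)
  finally have "2 ^ n * card (P \<inter> range Inr) < 2 ^ n * 1" using P(4) n by linarith
  then have "card (P \<inter> range Inr) = 0" by simp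
  moreover have "finite P" using P(1) finF finite_subset by auto
  ultimately have no_dummy: "P \<inter> range Inr = {}" by simp
  define proj :: "'a \<times> nat + 'b \<times> nat \<Rightarrow> 'a"
    where "proj = case_sum fst (\<lambda>_. undefined)"
  \<comment> \<open>a matched vertex lies on exactly one copy of one edge, so forgetting the copies is harmless\<close>
  have deg_proj: "deg (proj ` P) f x = (if x \<in> V then 1 else 0)"
    if "\<And>x. deg P (ext f) x = (if x \<in> V then 1 else 0)" for f x
  proof -
    have "f (proj z) = ext f z" if "z \<in> P" for z
      using that no_dummy by (cases z) (auto simp: ext_def proj_def)
    then have "{z \<in> P. f (proj z) = x} = {z \<in> P. ext f z = x}"
      by (intro Collect_cong conj_cong) simp_all
    then have im: "{e \<in> proj ` P. f e = x} = proj ` {z \<in> P. ext f z = x}" by blast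
    show ?thesis
    proof (cases "x \<in> V")
      case True
      then have "deg P (ext f) x = 1" using that[of x] by simp
      then obtain z where one: "{z \<in> P. ext f z = x} = {z}" by (rule card_1_singletonE)
      show ?thesis unfolding im one using True by simp
    next
      case False
      then have none: "{z \<in> P. ext f z = x} = {}"
        using that[of x] \<open>finite P\<close> by simp
      show ?thesis unfolding im none using False by simp
    qed
  qed
  have "proj z \<in> E" if "z \<in> P" for z
    using that P(1) no_dummy by (cases z) (auto simp: F_def proj_def)
  then have "proj ` P \<subseteq> E" by blast
  moreover have "deg (proj ` P) s x = (if x \<in> V then 1 else 0)"
    "deg (proj ` P) t x = (if x \<in> V then 1 else 0)" for x
    using deg_proj[of s x] deg_proj[of t x] P(2,3) by simp_all
  ultimately show ?thesis by (intro exI[of _ "proj ` P"]) simp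
qed

text \<open>
  Removing a perfect matching leaves a regular multigraph of degree one less, so the
  matchings can be peeled off one after the other; \<open>c\<close> records when an edge was removed.
\<close>

lemma regular_bipartite_factorization:
  assumes "finite E" "finite V"
    and "\<And>x. deg E s x = (if x \<in> V then k else 0)"
    and "\<And>y. deg E t y = (if y \<in> V then k else 0)"
  shows "\<exists>c. (\<forall>e \<in> E. c e < k) \<and>
    (\<forall>i < k. \<forall>x. deg {e \<in> E. c e = i} s x = (if x \<in> V then 1 else 0) \<and>
                deg {e \<in> E. c e = i} t x = (if x \<in> V then 1 else 0))"
  using assms
proof (induction k arbitrary: E)
  case 0
  have "e \<notin> E" for e
  proof
    assume "e \<in> E"
    then have "{e' \<in> E. s e' = s e} \<noteq> {}" by auto
    then show False using 0(1) 0(3)[of "s e"] by auto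
  qed
  then have "E = {}" by blast
  then show ?case by simp
next
  case (Suc k)
  obtain P where P: "P \<subseteq> E" "\<forall>x. deg P s x = (if x \<in> V then 1 else 0)"
    "\<forall>y. deg P t y = (if y \<in> V then 1 else 0)"
    using regular_bipartite_perfect_matching[of E V "Suc k" s t, OF Suc.prems(1,2) _ Suc.prems(3,4)]
    by (elim meta_impE exE conjE) simp
  have "deg (E - P) s x = (if x \<in> V then k else 0)" "deg (E - P) t x = (if x \<in> V then k else 0)" for x
    using card_Collect_split[OF Suc.prems(1) P(1), of "\<lambda>e. s e = x"]
      card_Collect_split[OF Suc.prems(1) P(1), of "\<lambda>e. t e = x"]
      P(2,3) Suc.prems(3,4)[of x] by (simp_all split: if_splits)
  from Suc.IH[of "E - P", OF finite_Diff[OF Suc.prems(1)] Suc.prems(2) this]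
  obtain c where c: "\<forall>e \<in> E - P. c e < k"
    "\<forall>i < k. \<forall>x. deg {e \<in> E - P. c e = i} s x = (if x \<in> V then 1 else 0) \<and>
                deg {e \<in> E - P. c e = i} t x = (if x \<in> V then 1 else 0)"
    by (elim exE conjE)
  define c' where "c' e = (if e \<in> P then k else c e)" for e
  have top: "{e \<in> E. c' e = k} = P" using P(1) c(1) by (auto simp: c'_def)
  have low: "{e \<in> E. c' e = i} = {e \<in> E - P. c e = i}" if "i < k" for i
    using that by (auto simp: c'_def)
  have "\<forall>e \<in> E. c' e < Suc k" using c(1) by (simp add: c'_def less_Suc_eq)
  moreover have "deg {e \<in> E. c' e = i} s x = (if x \<in> V then 1 else 0) \<and>
      deg {e \<in> E. c' e = i} t x = (if x \<in> V then 1 else 0)" if "i < Suc k" for i x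
  proof (cases "i = k")
    case True
    show ?thesis unfolding True top using P(2,3) by blast
  next
    case False
    then have i: "i < k" using that by simp
    show ?thesis unfolding low[OF i] using c(2) i by blast
  qed
  ultimately show ?case by blast
qed

section \<open>Labellings of a multigraph by generators and their inverses\<close>

text \<open>
  The label \<open>(i, True)\<close> stands for the generator \<open>\<sigma>\<^sub>i\<close> and \<open>(i, False)\<close> for its inverse. The
  axioms say that every vertex has exactly one outgoing arc for each of the \<open>2 * k\<close> letters
  and that an arc and its reverse carry inverse letters. This is exactly the combinatorial
  data of an action of the free group on \<open>k\<close> generators on the vertices.
\<close>

locale schreier_labelling = bidirected_digraph G \<rho>
  for G :: "('v, 'e) pre_digraph" and \<rho> :: "'e \<Rightarrow> 'e" +
  fixes k :: nat and \<l> :: "'e \<Rightarrow> nat \<times> bool"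
  assumes label_bij: "v \<in> verts G \<Longrightarrow> bij_betw \<l> (out_arcs G v) ({..<k} \<times> UNIV)"
    and label_rev: "a \<in> arcs G \<Longrightarrow> \<l> (\<rho> a) = apsnd Not (\<l> a)"

text \<open>
  Balanced orientation of the edges. The arcs form a bipartite multigraph joining vertices
  (by the tail map) to undirected edges (the sets \<open>{a, arev a}\<close>), with degrees \<open>2 * k\<close> and 2.
  Halving it chooses one arc from every edge and \<open>k\<close> of the \<open>2 * k\<close> arcs leaving each vertex.
\<close>

lemma (in bidirected_digraph) ex_half_orientation:
  assumes "fin_digraph G" "regular_multigraph (2 * k) G"
  shows "\<exists>P \<subseteq> arcs G. (\<forall>a \<in> arcs G. arev a \<in> P \<longleftrightarrow> a \<notin> P) \<and>
    (\<forall>v. deg P (tail G) v = (if v \<in> verts G then k else 0)) \<and>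
    (\<forall>v. deg P (head G) v = (if v \<in> verts G then k else 0))"
proof -
  interpret fin_digraph G by fact
  have out: "deg (arcs G) (tail G) v = (if v \<in> verts G then 2 * k else 0)" for v
  proof (cases "v \<in> verts G")
    case True
    then show ?thesis
      using assms(2) by (simp add: regular_multigraph_def out_degree_def out_arcs_def)
  next
    case False
    then have none: "{a \<in> arcs G. tail G a = v} = {}" by auto
    show ?thesis unfolding none using False by simp
  qed
  have edge: "{e \<in> arcs G. {e, arev e} = {a, arev a}} = {a, arev a}" if "a \<in> arcs G" for a
    using that by (auto simp: doubleton_eq_iff)
  have "even (deg (arcs G) (\<lambda>a. {a, arev a}) y)" for y
  proof (cases "\<exists>a \<in> arcs G. {a, arev a} = y")
    case True
    then obtain a where a: "a \<in> arcs G" "{a, arev a} = y" by blast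
    then have "deg (arcs G) (\<lambda>a. {a, arev a}) y = card {a, arev a}" using edge[OF a(1)] by simp
    also have "\<dots> = 2" using arev_neq[OF a(1)] by simp
    finally show ?thesis by simp
  next
    case False
    then have none: "{a \<in> arcs G. {a, arev a} = y} = {}" by blast
    show ?thesis unfolding none by simp
  qed
  then obtain P where P: "P \<subseteq> arcs G" "\<forall>v. deg (arcs G) (tail G) v = 2 * deg P (tail G) v"
    "\<forall>y. deg (arcs G) (\<lambda>a. {a, arev a}) y = 2 * deg P (\<lambda>a. {a, arev a}) y"
    using split_even_degrees[of "arcs G" "tail G" "\<lambda>a. {a, arev a}"] out
    by (elim meta_impE exE conjE) simp_all
  have P_out: "deg P (tail G) v = (if v \<in> verts G then k else 0)" for v
    using out[of v] P(2)[rule_format, of v] by (auto split: if_splits)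
  have rev: "arev a \<in> P \<longleftrightarrow> a \<notin> P" if a: "a \<in> arcs G" for a
  proof -
    have "2 * deg P (\<lambda>a. {a, arev a}) {a, arev a} = 2"
      using P(3)[rule_format, of "{a, arev a}"] edge[OF a] arev_neq[OF a] by simp
    moreover have "{e \<in> P. {e, arev e} = {a, arev a}} = P \<inter> {a, arev a}"
      using edge[OF a] P(1) by blast
    ultimately have "card (P \<inter> {a, arev a}) = 1" by simp
    then obtain z where z: "P \<inter> {a, arev a} = {z}" by (rule card_1_singletonE)
    have "z = a \<or> z = arev a" "a \<in> P \<longleftrightarrow> a = z" "arev a \<in> P \<longleftrightarrow> arev a = z" using z by blast+
    then show ?thesis using arev_neq[OF a] by metis
  qed
  have P_in: "deg P (head G) v = (if v \<in> verts G then k else 0)" for v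
  proof -
    have "bij_betw arev {a \<in> P. head G a = v} {a \<in> arcs G - P. tail G a = v}"
      using P(1) rev by (intro bij_betw_byWitness[where f' = arev]) auto
    then have "deg P (head G) v = deg (arcs G - P) (tail G) v" by (rule bij_betw_same_card)
    then show ?thesis
      using card_Collect_split[OF finite_arcs P(1), of "\<lambda>a. tail G a = v"] out[of v] P_out[of v]
      by (auto split: if_splits)
  qed
  show ?thesis using P(1) rev P_out P_in by (intro exI[of _ P]) simp
qed

text \<open>
  Petersen's 2-factor theorem. In a balanced orientation the tail and head maps make the
  chosen arcs a \<open>k\<close>-regular bipartite multigraph; its \<open>k\<close> perfect matchings are permutations
  of the vertices, and the \<open>i\<close>-th one receives the letter \<open>i\<close>.
\<close>

lemma (in bidirected_digraph) ex_schreier_labelling: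
  assumes "fin_digraph G" "regular_multigraph (2 * k) G"
  shows "\<exists>\<l>. schreier_labelling G arev k \<l>"
proof -
  interpret fin_digraph G by fact
  obtain P where P: "P \<subseteq> arcs G" "\<forall>a \<in> arcs G. arev a \<in> P \<longleftrightarrow> a \<notin> P"
    "\<forall>v. deg P (tail G) v = (if v \<in> verts G then k else 0)"
    "\<forall>v. deg P (head G) v = (if v \<in> verts G then k else 0)"
    using ex_half_orientation[OF assms] by (elim exE conjE)
  have finP: "finite P" using P(1) finite_arcs by (rule finite_subset)
  obtain c where c: "\<forall>e \<in> P. c e < k"
    "\<forall>i < k. \<forall>v. deg {e \<in> P. c e = i} (tail G) v = (if v \<in> verts G then 1 else 0) \<and>
                deg {e \<in> P. c e = i} (head G) v = (if v \<in> verts G then 1 else 0)"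
    using regular_bipartite_factorization[of P "verts G" "tail G" k "head G",
      OF finP finite_verts P(3)[rule_format] P(4)[rule_format]] by (elim exE conjE)
  define \<l> where "\<l> a = (if a \<in> P then (c a, True) else (c (arev a), False))" for a
  have label_rev: "\<l> (arev a) = apsnd Not (\<l> a)" if "a \<in> arcs G" for a
    using P(2) that by (simp add: \<l>_def)
  have label_bij: "bij_betw \<l> (out_arcs G v) ({..<k} \<times> UNIV)" if v: "v \<in> verts G" for v
  proof -
    have range: "\<l> ` out_arcs G v \<subseteq> {..<k} \<times> UNIV"
      using c(1) P(2) by (auto simp: \<l>_def)
    have "(i, b) \<in> \<l> ` out_arcs G v" if i: "i < k" for i b
    proof (cases b)
      case True
      have "deg {e \<in> P. c e = i} (tail G) v = 1" using c(2) v i by simp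
      then obtain a where "{e \<in> {e \<in> P. c e = i}. tail G e = v} = {a}" by (rule card_1_singletonE)
      then have "a \<in> P" "c a = i" "tail G a = v" by auto
      then show ?thesis using True P(1) by (intro image_eqI[of _ _ a]) (auto simp: \<l>_def)
    next
      case False
      have "deg {e \<in> P. c e = i} (head G) v = 1" using c(2) v i by simp
      then obtain a where "{e \<in> {e \<in> P. c e = i}. head G e = v} = {a}" by (rule card_1_singletonE)
      then have "a \<in> P" "c a = i" "head G a = v" "a \<in> arcs G" using P(1) by auto
      then show ?thesis using False P(2) by (intro image_eqI[of _ _ "arev a"]) (auto simp: \<l>_def)
    qed
    with range have im: "\<l> ` out_arcs G v = {..<k} \<times> UNIV" by auto
    have "card (out_arcs G v) = 2 * k"
      using assms(2) v by (simp add: regular_multigraph_def out_degree_def)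
    \<comment> \<open>a surjection between finite sets of the same size \<open>2 * k\<close> is injective\<close>
    then have "inj_on \<l> (out_arcs G v)"
      using im by (intro eq_card_imp_inj_on) (simp_all add: card_cartesian_product out_arcs_def)
    then show ?thesis using im by (simp add: bij_betw_def)
  qed
  have "schreier_labelling G arev k \<l>"
    using label_bij label_rev by unfold_locales
  then show ?thesis by blast
qed

text \<open>
  A covering is bijective on stars and commutes with reversal, so labels pull back.
\<close>

lemma schreier_labelling_lift:
  assumes "bidirected_digraph G \<rho>" "schreier_labelling H \<rho>' k \<l>" "multigraph_covering G \<rho> H \<rho>' f g"
  shows "schreier_labelling G \<rho> k (\<l> \<circ> g)"
proof -
  interpret G: bidirected_digraph G \<rho> by fact
  interpret H: schreier_labelling H \<rho>' k \<l> by fact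
  have hom: "multigraph_hom G \<rho> H \<rho>' f g" using assms(3) by (simp add: multigraph_covering_def)
  show ?thesis
  proof
    fix v assume v: "v \<in> verts G"
    have "bij_betw g (out_arcs G v) (out_arcs H (f v))" "f v \<in> verts H"
      using v hom assms(3) by (auto simp: multigraph_covering_def multigraph_hom_def)
    then show "bij_betw (\<l> \<circ> g) (out_arcs G v) ({..<k} \<times> UNIV)"
      using H.label_bij bij_betw_trans by blast
  next
    fix a assume "a \<in> arcs G"
    then have "g (\<rho> a) = \<rho>' (g a)" "g a \<in> arcs H" using hom by (auto simp: multigraph_hom_def)
    then show "(\<l> \<circ> g) (\<rho> a) = apsnd Not ((\<l> \<circ> g) a)" by (simp add: H.label_rev)
  qed
qed

context schreier_labelling
begin

text \<open>
  The permutation of the vertices by which the letter \<open>x\<close> acts.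
\<close>

definition follow :: "nat \<times> bool \<Rightarrow> 'v \<Rightarrow> 'v" where
  "follow x v = head G (inv_into (out_arcs G v) \<l> x)"

lemma label_inj:
  assumes "a \<in> arcs G" "b \<in> arcs G" "tail G a = tail G b" "\<l> a = \<l> b"
  shows "a = b"
  using label_bij[of "tail G a"] assms by (auto simp: bij_betw_def inj_on_def)

lemma label_in:
  assumes "a \<in> arcs G"
  shows "fst (\<l> a) < k"
proof -
  have "\<l> a \<in> {..<k} \<times> UNIV"
    using bij_betwE[OF label_bij[OF tail_in_verts[OF assms]]] assms by simp
  then show ?thesis by auto
qed

lemma follow_label: "a \<in> arcs G \<Longrightarrow> follow (\<l> a) (tail G a) = head G a"
  using label_bij[of "tail G a"] by (simp add: follow_def bij_betw_def)

lemma ex_arc_with_label: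
  assumes "v \<in> verts G" "i < k"
  obtains a where "a \<in> arcs G" "tail G a = v" "\<l> a = (i, b)"
proof -
  have "(i, b) \<in> \<l> ` out_arcs G v"
    using label_bij[OF assms(1)] assms(2) by (simp add: bij_betw_def)
  then show ?thesis using that by auto
qed

lemma follow_in_verts: "v \<in> verts G \<Longrightarrow> i < k \<Longrightarrow> follow (i, b) v \<in> verts G"
  using ex_arc_with_label[of v i b] follow_label head_in_verts by metis

lemma follow_back:
  assumes "v \<in> verts G" "i < k"
  shows "follow (i, \<not> b) (follow (i, b) v) = v"
proof -
  obtain a where a: "a \<in> arcs G" "tail G a = v" "\<l> a = (i, b)"
    using ex_arc_with_label[OF assms] .
  then show ?thesis using follow_label[OF a(1)] follow_label[of "\<rho> a"] label_rev[OF a(1)] by simp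
qed

lemma bij_betw_follow:
  assumes "i < k"
  shows "bij_betw (follow (i, b)) (verts G) (verts G)"
  using assms follow_in_verts follow_back[of _ i b] follow_back[of _ i "\<not> b"]
  by (intro bij_betw_byWitness[where f' = "follow (i, \<not> b)"]) auto

end

text \<open>
  The covering maps the arc labelled \<open>(i, b)\<close> at \<open>v\<close> to the one labelled \<open>(i, b)\<close> at \<open>f v\<close>,
  so it is equivariant. This compatibility lets the permutations of the different levels fit
  together to an automorphism of the tree.
\<close>

lemma follow_covering:
  assumes "bidirected_digraph G \<rho>" "schreier_labelling H \<rho>' k \<l>" "multigraph_covering G \<rho> H \<rho>' f g"
    and v: "v \<in> verts G" "i < k"
  shows "f (schreier_labelling.follow G (\<l> \<circ> g) (i, b) v) = schreier_labelling.follow H \<l> (i, b) (f v)"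
proof -
  interpret H: schreier_labelling H \<rho>' k \<l> by fact
  interpret G: schreier_labelling G \<rho> k "\<l> \<circ> g" by (rule schreier_labelling_lift) fact+
  obtain a where a: "a \<in> arcs G" "tail G a = v" "(\<l> \<circ> g) a = (i, b)"
    using G.ex_arc_with_label[OF v] .
  have "g a \<in> arcs H" "tail H (g a) = f v" "head H (g a) = f (head G a)"
    using assms(3) a by (auto simp: multigraph_covering_def multigraph_hom_def)
  then show ?thesis using H.follow_label[of "g a"] G.follow_label[OF a(1)] a by simp
qed

section \<open>The rooted tree of an inverse sequence of sets\<close>

text \<open>
  \<open>L n\<close> becomes the \<open>n\<close>-th level of a tree in which \<open>p n w\<close> is the parent of a vertex \<open>w\<close> of
  level \<open>n + 1\<close>.
\<close>

locale inverse_sequence =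
  fixes L :: "nat \<Rightarrow> 'v set" and p :: "nat \<Rightarrow> 'v \<Rightarrow> 'v" and x0 :: 'v
  assumes level_0: "L 0 = {x0}"
    and proj_in: "w \<in> L (Suc n) \<Longrightarrow> p n w \<in> L n"
begin

definition parent :: "nat \<times> 'v \<Rightarrow> nat \<times> 'v" where
  "parent x = (fst x - 1, p (fst x - 1) (snd x))"

definition level_tree :: "(nat \<times> 'v) pair_pre_digraph" where
  "level_tree = \<lparr>pverts = Sigma UNIV L,
     parcs = {(x, y). x \<in> Sigma UNIV L \<and> y \<in> Sigma UNIV L \<and>
       (fst x > 0 \<and> y = parent x \<or> fst y > 0 \<and> x = parent y)}\<rparr>"

lemma pverts_level_tree: "pverts level_tree = Sigma UNIV L"
  by (simp add: level_tree_def)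

lemma parcs_level_tree: "(x, y) \<in> parcs level_tree \<longleftrightarrow>
    x \<in> Sigma UNIV L \<and> y \<in> Sigma UNIV L \<and>
    (fst x > 0 \<and> y = parent x \<or> fst y > 0 \<and> x = parent y)"
  by (simp add: level_tree_def)

lemma parent_in:
  assumes "x \<in> Sigma UNIV L" "fst x > 0"
  shows "parent x \<in> Sigma UNIV L"
proof -
  obtain n w where "x = (Suc n, w)" using assms(2) by (metis gr0_conv_Suc prod.collapse)
  then show ?thesis using assms(1) proj_in[of w n] by (simp add: parent_def)
qed

lemma pair_bidirected_level_tree: "pair_bidirected_digraph level_tree"
proof
  fix e assume "e \<in> parcs level_tree"
  then show "fst e \<in> pverts level_tree" "snd e \<in> pverts level_tree"
    by (cases e; simp only: parcs_level_tree pverts_level_tree fst_conv snd_conv)+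
  show "fst e \<noteq> snd e"
    using \<open>e \<in> parcs level_tree\<close>
    by (cases e) (auto simp: level_tree_def parent_def prod_eq_iff)
next
  show "symmetric (with_proj level_tree)"
    by (auto simp: symmetric_def sym_def parcs_level_tree)
qed

interpretation pair_bidirected_digraph level_tree
  by (rule pair_bidirected_level_tree)

lemma level_change: "(x, y) \<in> parcs level_tree \<Longrightarrow> fst y \<le> Suc (fst x)"
  by (auto simp: parcs_level_tree parent_def)

lemma towards_root: "(x, y) \<in> parcs level_tree \<Longrightarrow> fst y \<le> fst x \<Longrightarrow> y = parent x"
  by (auto simp: parcs_level_tree parent_def)

lemma awalk_level_le: "awalk u q v \<Longrightarrow> fst v \<le> fst u + length q"
proof (induction q arbitrary: u)
  case Nil
  then show ?case by (simp add: awalk_Nil_iff)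
next
  case (Cons a q)
  then have "a \<in> parcs level_tree" "fst a = u" "awalk (snd a) q v" by (auto simp: awalk_Cons_iff)
  then show ?case using Cons.IH[of "snd a"] level_change[of "fst a" "snd a"] by auto
qed

lemma ex_awalk_from_root:
  "v \<in> L n \<Longrightarrow> \<exists>q. awalk (0, x0) q (n, v) \<and> length q = n"
proof (induction n arbitrary: v)
  case 0
  then show ?case
    by (intro exI[of _ "[]"]) (simp add: level_0 awalk_Nil_iff pverts_level_tree)
next
  case (Suc n)
  obtain q where q: "awalk (0, x0) q (n, p n v)" "length q = n"
    using Suc.IH[OF proj_in[OF Suc.prems]] by blast
  have "((n, p n v), (Suc n, v)) \<in> parcs level_tree"
    using Suc.prems proj_in[OF Suc.prems] by (simp add: parcs_level_tree parent_def)
  then have "awalk (n, p n v) [((n, p n v), (Suc n, v))] (Suc n, v)"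
    using arc_implies_awalk by fastforce
  then have "awalk (0, x0) (q @ [((n, p n v), (Suc n, v))]) (Suc n, v)"
    using q(1) by (rule awalk_appendI[rotated])
  then show ?case using q(2) by (intro exI[of _ "q @ [((n, p n v), (Suc n, v))]"]) simp
qed

text \<open>
  Each step of a walk raises the level by at most one, and the walk through the ancestors of
  a vertex attains this bound.
\<close>

lemma distance_from_root:
  assumes "v \<in> L n"
  shows "wf_digraph.\<mu> (with_proj level_tree) (\<lambda>_. 1) (0, x0) (n, v) = ereal (real n)"
proof -
  have cost: "awalk_cost (\<lambda>_. 1) q = real (length q)" for q :: "((nat \<times> 'v) \<times> (nat \<times> 'v)) list"
    by (simp add: awalk_cost_def sum_list_triv)
  obtain q where q: "awalk (0, x0) q (n, v)" "length q = n"
    using ex_awalk_from_root[OF assms] by blast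
  show ?thesis
    unfolding \<mu>_def
  proof (rule antisym)
    show "(INF p\<in>{p. awalk (0, x0) p (n, v)}. ereal (awalk_cost (\<lambda>_. 1) p)) \<le> ereal (real n)"
      using q by (intro INF_lower2[of q]) (simp_all add: cost)
    show "ereal (real n) \<le> (INF p\<in>{p. awalk (0, x0) p (n, v)}. ereal (awalk_cost (\<lambda>_. 1) p))"
    proof (rule INF_greatest)
      fix q assume "q \<in> {p. awalk (0, x0) p (n, v)}"
      then have "n \<le> length q" using awalk_level_le[of "(0, x0)" q "(n, v)"] by simp
      then show "ereal (real n) \<le> ereal (awalk_cost (\<lambda>_. 1) q)" by (simp add: cost)
    qed
  qed
qed

lemma tree_level_level_tree: "tree_level level_tree (0, x0) n = {n} \<times> L n"
  using distance_from_root by (auto simp: tree_level_def pverts_level_tree)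

lemma connected_level_tree: "Digraph_Component.connected (with_proj level_tree)"
proof -
  have "mk_symmetric (with_proj level_tree) = level_tree"
    using arcs_symmetric by (intro pair_pre_digraph.equality) (auto simp: mk_symmetric_def)
  moreover have "strongly_connected (with_proj level_tree)"
  proof (rule strongly_connectedI)
    show "verts (with_proj level_tree) \<noteq> {}"
      using level_0 by (auto simp: pverts_level_tree)
    fix u v assume "u \<in> verts (with_proj level_tree)" "v \<in> verts (with_proj level_tree)"
    then obtain q q' where "awalk (0, x0) q u" "awalk (0, x0) q' v"
      using ex_awalk_from_root by (fastforce simp: pverts_level_tree)
    then have "awalk u (rev_path q @ q') v" by (intro awalk_appendI) simp_all
    then show "u \<rightarrow>\<^sup>*\<^bsub>with_proj level_tree\<^esub> v" by (rule reachable_awalkI)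
  qed
  ultimately show ?thesis by (simp add: Digraph_Component.connected_def)
qed

lemma pcas_consecutive: "pcas u q v \<Longrightarrow> Suc i < length q \<Longrightarrow> snd (q ! i) = fst (q ! Suc i)"
proof (induction q arbitrary: u i)
  case (Cons a q)
  then show ?case by (cases i; cases q) auto
qed simp

lemma pcas_last: "pcas u q v \<Longrightarrow> q \<noteq> [] \<Longrightarrow> snd (last q) = v"
  by (induction q arbitrary: u) auto

lemma tl_pawalk_verts: "pcas u q v \<Longrightarrow> tl (pawalk_verts u q) = map snd q"
proof (induction q arbitrary: u)
  case (Cons a q)
  then show ?case by (cases q) auto
qed simp

text \<open>
  A vertex of maximal level on a cycle has two neighbours there, neither of them on a higher
  level. Both are therefore its parent, which is impossible on a cycle of length at least 3.
\<close>

lemma no_cycle_level_tree: "\<not> (\<exists>q. pre_digraph.cycle (with_proj level_tree) q \<and> 3 \<le> length q)"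
proof
  assume "\<exists>q. pre_digraph.cycle (with_proj level_tree) q \<and> 3 \<le> length q"
  then obtain q u where q: "awalk u q u" "distinct (tl (pawalk_verts u q))" "3 \<le> length q"
    unfolding cycle_def by auto
  define m where "m = length q"
  define y where "y i = snd (q ! i)" for i
  have cas: "pcas u q u" and arcs: "set q \<subseteq> parcs level_tree"
    using q(1) by (auto simp: awalk_def)
  have y_inj: "i = j" if "y i = y j" "i < m" "j < m" for i j
    using q(2) that by (simp add: tl_pawalk_verts[OF cas] y_def m_def distinct_conv_nth)
      metis
  have step: "(y (if i = 0 then m - 1 else i - 1), y i) \<in> parcs level_tree" if "i < m" for i
  proof -
    have "fst (q ! i) = y (if i = 0 then m - 1 else i - 1)"
    proof (cases i)
      case 0
      have ne: "q \<noteq> []" using q(3) by auto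
      have "fst (q ! 0) = u" using cas ne by (cases q) auto
      moreover have "snd (q ! (m - 1)) = u"
        using pcas_last[OF cas ne] ne by (simp add: last_conv_nth m_def)
      ultimately show ?thesis using 0 by (simp add: y_def)
    next
      case (Suc j)
      then show ?thesis using pcas_consecutive[OF cas, of j] that by (simp add: y_def m_def)
    qed
    then have "q ! i = (y (if i = 0 then m - 1 else i - 1), y i)"
      by (intro prod_eqI) (simp_all add: y_def)
    moreover have "q ! i \<in> parcs level_tree" using arcs that by (auto simp: m_def)
    ultimately show ?thesis by simp
  qed
  let ?levels = "(\<lambda>i. fst (y i)) ` {..<m}"
  have "0 < m" using q(3) unfolding m_def by linarith
  then have "0 \<in> {..<m}" by simp
  then have "{..<m} \<noteq> {}" by blast
  then have "Max ?levels \<in> ?levels" by (intro Max_in) simp_all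
  then obtain i where i0: "i < m" "Max ?levels = fst (y i)" by auto
  have "fst (y j) \<le> fst (y i)" if "j < m" for j
    using that Max_ge[of ?levels "fst (y j)"] i0(2) by simp
  note i = i0(1) this
  \<comment> \<open>the cyclic predecessor and successor of \<open>i\<close>\<close>
  define j where "j = (if i = 0 then m - 1 else i - 1)"
  define k where "k = (if Suc i = m then 0 else Suc i)"
  have jk: "j < m" "k < m" "j \<noteq> k" using i(1) q(3) by (auto simp: j_def k_def m_def)
  have "(y j, y i) \<in> parcs level_tree" using step[OF i(1)] by (simp add: j_def)
  then have "y j = parent (y i)" using arcs_symmetric i(2)[OF jk(1)] towards_root by blast
  moreover have "(if k = 0 then m - 1 else k - 1) = i" using i(1) by (auto simp: k_def)
  then have "(y i, y k) \<in> parcs level_tree" using step[OF jk(2)] by simp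
  then have "y k = parent (y i)" using i(2)[OF jk(2)] towards_root by blast
  ultimately show False using y_inj[of j k] jk by simp
qed

lemma rooted_level_tree: "rooted_tree level_tree (0, x0)"
  using connected_level_tree no_cycle_level_tree level_0
  by unfold_locales (auto simp: pverts_level_tree)

text \<open>
  Automorphisms are extensional functions on the vertex set, whence the restriction.
\<close>

definition tree_map :: "(nat \<Rightarrow> 'v \<Rightarrow> 'v) \<Rightarrow> nat \<times> 'v \<Rightarrow> nat \<times> 'v" where
  "tree_map s = restrict (\<lambda>(n, v). (n, s n v)) (Sigma UNIV L)"

text \<open>
  Commuting with the projections means preserving the parent relation, and injectivity makes
  it reflect this relation as well.
\<close>

lemma tree_map_in_Aut:
  assumes s: "\<And>n. bij_betw (s n) (L n) (L n)"
    and comm: "\<And>n w. w \<in> L (Suc n) \<Longrightarrow> p n (s (Suc n) w) = s n (p n w)"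
  shows "tree_map s \<in> carrier (tree_Aut level_tree (0, x0))"
proof -
  let ?V = "Sigma UNIV L" and ?F = "tree_map s"
  have F: "?F (n, v) = (n, s n v)" if "v \<in> L n" for n v
    using that by (simp add: tree_map_def)
  have s_in: "s n v \<in> L n" if "v \<in> L n" for n v
    using bij_betwE[OF s] that by blast
  have F_in: "?F x \<in> ?V" "fst (?F x) = fst x" if "x \<in> ?V" for x
    using that F s_in by auto
  have inj: "inj_on ?F ?V"
  proof (rule inj_onI)
    fix x y assume xy: "x \<in> ?V" "y \<in> ?V" "?F x = ?F y"
    obtain n v where x: "x = (n, v)" "v \<in> L n" using xy(1) by (elim SigmaE) simp
    obtain m w where y: "y = (m, w)" "w \<in> L m" using xy(2) by (elim SigmaE) simp
    have "(n, s n v) = (m, s m w)"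
      using xy(3) unfolding x(1) y(1) F[OF x(2)] F[OF y(2)] .
    then have nm: "m = n" "s n v = s n w" by auto
    have "v = w"
      using inj_onD[OF bij_betw_imp_inj_on[OF s[of n]] nm(2) x(2)] y(2) nm(1) by simp
    then show "x = y" using x(1) y(1) nm(1) by simp
  qed
  have "?F ` ?V = ?V"
  proof
    show "?F ` ?V \<subseteq> ?V" using F_in by blast
    show "?V \<subseteq> ?F ` ?V"
    proof
      fix x assume "x \<in> ?V"
      then obtain n v where x: "x = (n, v)" "v \<in> L n" by (elim SigmaE) simp
      then have "v \<in> s n ` L n" using s[of n] by (simp add: bij_betw_def)
      then obtain w where w: "w \<in> L n" "v = s n w" by blast
      then have "x = ?F (n, w)" using x(1) F[OF w(1)] by simp
      then show "x \<in> ?F ` ?V" using w(1) by (intro image_eqI[of _ _ "(n, w)"]) simp_all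
    qed
  qed
  then have "?F \<in> Bij ?V" using inj by (simp add: Bij_def bij_betw_def tree_map_def)
  moreover have "?F (0, x0) = (0, x0)"
    using F[of x0 0] s_in[of x0 0] by (simp add: level_0)
  moreover have "((?F x, ?F y) \<in> parcs level_tree) = ((x, y) \<in> parcs level_tree)"
    if xy: "x \<in> ?V" "y \<in> ?V" for x y
  proof -
    have parent_F: "(?F b = parent (?F a)) = (b = parent a)"
      if "a \<in> ?V" "b \<in> ?V" "fst a > 0" for a b
    proof -
      obtain n w where a: "a = (Suc n, w)" "w \<in> L (Suc n)"
        using \<open>a \<in> ?V\<close> gr0_implies_Suc[OF \<open>fst a > 0\<close>] by (cases a) auto
      then have "parent (?F a) = ?F (parent a)"
        using proj_in[of w n] by (simp add: F parent_def comm)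
      then show ?thesis
        using inj_on_eq_iff[OF inj \<open>b \<in> ?V\<close> parent_in[OF \<open>a \<in> ?V\<close> \<open>fst a > 0\<close>]] by simp
    qed
    have "(fst (?F x) > 0 \<and> ?F y = parent (?F x)) = (fst x > 0 \<and> y = parent x)"
      "(fst (?F y) > 0 \<and> ?F x = parent (?F y)) = (fst y > 0 \<and> x = parent y)"
      using parent_F[OF xy] parent_F[OF xy(2,1)] F_in(2)[OF xy(1)] F_in(2)[OF xy(2)]
      by (simp_all cong: conj_cong)
    then show ?thesis
      unfolding parcs_level_tree using F_in(1)[OF xy(1)] F_in(1)[OF xy(2)] xy by blast
  qed
  ultimately show ?thesis by (simp add: tree_Aut_def pverts_level_tree)
qed

end

section \<open>Recognizing Schreier graphs\<close>

text \<open>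
  An arc of the Schreier graph is named by the starting point of the generator's arrow, also
  when the arc traverses the arrow backwards; hence an arc with negative label is sent to a
  triple beginning with its head instead of its tail.
\<close>

lemma (in schreier_labelling) isomorphic_schreier_graph:
  fixes gs :: "'g list" and \<phi> :: "'g \<Rightarrow> 'm \<Rightarrow> 'm"
  assumes h: "bij_betw h (verts G) M" and k: "length gs = k"
    and act: "\<And>i v. i < k \<Longrightarrow> v \<in> verts G \<Longrightarrow> \<phi> (gs ! i) (h v) = h (follow (i, True) v)"
  shows "multigraph_isomorphic G \<rho> (schreier_graph \<phi> M gs) (schreier_rev M gs)"
proof -
  define \<gamma> where "\<gamma> a = (h (if snd (\<l> a) then tail G a else head G a), \<l> a)" for a
  have h_in: "h v \<in> M" if "v \<in> verts G" for v using bij_betwE[OF h] that by blast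
  have h_inj: "h v = h w \<longleftrightarrow> v = w" if "v \<in> verts G" "w \<in> verts G" for v w
    using inj_on_eq_iff[OF bij_betw_imp_inj_on[OF h] that] .
  have hom: "\<gamma> a \<in> arcs (schreier_graph \<phi> M gs) \<and>
      tail (schreier_graph \<phi> M gs) (\<gamma> a) = h (tail G a) \<and>
      head (schreier_graph \<phi> M gs) (\<gamma> a) = h (head G a) \<and>
      \<gamma> (\<rho> a) = schreier_rev M gs (\<gamma> a)" if a: "a \<in> arcs G" for a
  proof -
    obtain i b where l: "\<l> a = (i, b)" by (cases "\<l> a")
    have i: "i < k" using label_in[OF a] l by simp
    have rev: "\<l> (\<rho> a) = (i, \<not> b)" using label_rev[OF a] l by simp
    show ?thesis
    proof (cases b)
      case True
      have "\<phi> (gs ! i) (h (tail G a)) = h (head G a)"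
        using act[OF i tail_in_verts[OF a]] follow_label[OF a] l True by simp
      then show ?thesis
        using True l rev i a h_in[of "tail G a"] k
        by (simp add: \<gamma>_def schreier_graph_def schreier_rev_def)
    next
      case False
      have "\<phi> (gs ! i) (h (head G a)) = h (tail G a)"
        using act[OF i head_in_verts[OF a]] follow_label[of "\<rho> a"] rev False a by simp
      then show ?thesis
        using False l rev i a h_in[of "head G a"] k
        by (simp add: \<gamma>_def schreier_graph_def schreier_rev_def)
    qed
  qed
  have "inj_on \<gamma> (arcs G)"
  proof (rule inj_onI)
    fix a b assume a: "a \<in> arcs G" and b: "b \<in> arcs G" and eq: "\<gamma> a = \<gamma> b"
    have l: "\<l> a = \<l> b" using eq by (simp add: \<gamma>_def)
    show "a = b"
    proof (cases "snd (\<l> a)")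
      case True
      then have "tail G a = tail G b" using eq l a b h_inj by (simp add: \<gamma>_def)
      then show ?thesis using label_inj[OF a b] l by simp
    next
      case False
      then have "head G a = head G b" using eq l a b h_inj by (simp add: \<gamma>_def)
      then have "\<rho> a = \<rho> b" using label_inj[of "\<rho> a" "\<rho> b"] label_rev a b l by simp
      then show ?thesis using arev_arev by metis
    qed
  qed
  moreover have "\<gamma> ` arcs G = arcs (schreier_graph \<phi> M gs)"
  proof
    show "\<gamma> ` arcs G \<subseteq> arcs (schreier_graph \<phi> M gs)" using hom by blast
    show "arcs (schreier_graph \<phi> M gs) \<subseteq> \<gamma> ` arcs G"
    proof
      fix x assume "x \<in> arcs (schreier_graph \<phi> M gs)"
      then obtain m i b where x: "x = (m, i, b)" "m \<in> M" "i < k"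
        using k by (auto simp: schreier_graph_def)
      obtain v where v: "v \<in> verts G" "m = h v"
        using x(2) bij_betw_imp_surj_on[OF h] by blast
      obtain a where a: "a \<in> arcs G" "tail G a = v" "\<l> a = (i, True)"
        using ex_arc_with_label[OF v(1) x(3)] .
      show "x \<in> \<gamma> ` arcs G"
      proof (cases b)
        case True
        then have "x = \<gamma> a" using a v(2) x(1) by (simp add: \<gamma>_def)
        then show ?thesis using a(1) by blast
      next
        case False
        then have "x = \<gamma> (\<rho> a)" using a v(2) x(1) label_rev[OF a(1)] by (simp add: \<gamma>_def)
        then show ?thesis using arev_in_arcs[OF a(1)] by blast
      qed
    qed
  qed
  ultimately have "bij_betw \<gamma> (arcs G) (arcs (schreier_graph \<phi> M gs))" by (simp add: bij_betw_def)
  moreover have "multigraph_hom G \<rho> (schreier_graph \<phi> M gs) (schreier_rev M gs) h \<gamma>"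
    using hom h_in unfolding multigraph_hom_def by (simp add: schreier_graph_def)
  moreover have "bij_betw h (verts G) (verts (schreier_graph \<phi> M gs))"
    using h by (simp add: schreier_graph_def)
  ultimately show ?thesis unfolding multigraph_isomorphic_def by blast
qed

section \<open>Realization by Schreier graphs\<close>

theorem proposition3p0p1:
  fixes k :: nat
    and \<Gamma> :: "nat \<Rightarrow> ('v, 'e) pre_digraph"
    and \<rho> :: "nat \<Rightarrow> 'e \<Rightarrow> 'e"
  assumes "k \<ge> 1"
    and "\<And>n. n \<ge> 1 \<Longrightarrow> finite_connected_multigraph (\<Gamma> n) (\<rho> n)"
    and "\<And>n. n \<ge> 1 \<Longrightarrow> regular_multigraph (2 * k) (\<Gamma> n)"
    and "\<And>n. n \<ge> 1 \<Longrightarrow>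
           \<exists>f g. multigraph_covering (\<Gamma> (Suc n)) (\<rho> (Suc n)) (\<Gamma> n) (\<rho> n) f g"
  shows "\<exists>(T :: (nat \<times> 'v) pair_pre_digraph) r G \<sigma>s.
           rooted_tree T r \<and>
           subgroup G (tree_Aut T r) \<and>
           length \<sigma>s = k \<and> set \<sigma>s \<subseteq> G \<and> generate (tree_Aut T r) (set \<sigma>s) = G \<and>
           (\<forall>n \<ge> 1. multigraph_isomorphic (\<Gamma> n) (\<rho> n)
              (schreier_graph (level_action T r n) (tree_level T r n) \<sigma>s)
              (schreier_rev (tree_level T r n) \<sigma>s))"
proof -
  have bidir: "bidirected_digraph (\<Gamma> (Suc n)) (\<rho> (Suc n))" for n
    using assms(2)[of "Suc n"] by (simp add: finite_connected_multigraph_def)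
  have "\<forall>n. \<exists>f g. multigraph_covering (\<Gamma> (Suc (Suc n))) (\<rho> (Suc (Suc n))) (\<Gamma> (Suc n)) (\<rho> (Suc n)) f g"
    using assms(4) by simp
  then obtain f g where cov:
    "\<And>n. multigraph_covering (\<Gamma> (Suc (Suc n))) (\<rho> (Suc (Suc n))) (\<Gamma> (Suc n)) (\<rho> (Suc n)) (f n) (g n)"
    by metis
  have "\<exists>\<l>. schreier_labelling (\<Gamma> 1) (\<rho> 1) k \<l>"
    using assms(2,3)[of 1]
    by (intro bidirected_digraph.ex_schreier_labelling) (simp_all add: finite_connected_multigraph_def)
  then obtain \<l>\<^sub>1 where \<l>\<^sub>1: "schreier_labelling (\<Gamma> 1) (\<rho> 1) k \<l>\<^sub>1" ..
  \<comment> \<open>indices are shifted: \<open>\<l> n\<close> labels \<open>\<Gamma> (n + 1)\<close>, and \<open>f n\<close>, \<open>g n\<close> cover it by \<open>\<Gamma> (n + 2)\<close>\<close>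
  define \<l> where "\<l> = rec_nat \<l>\<^sub>1 (\<lambda>n l. l \<circ> g n)"
  have \<l>_Suc: "\<l> (Suc n) = \<l> n \<circ> g n" for n by (simp add: \<l>_def)
  have lab: "schreier_labelling (\<Gamma> (Suc n)) (\<rho> (Suc n)) k (\<l> n)" for n
  proof (induction n)
    case 0
    then show ?case using \<l>\<^sub>1 by (simp add: \<l>_def)
  next
    case (Suc n)
    show ?case unfolding \<l>_Suc by (rule schreier_labelling_lift[OF bidir Suc cov])
  qed
  \<comment> \<open>the graphs begin at level 1, below a root added as level 0 and represented by \<open>undefined\<close>\<close>
  define L where "L n = (case n of 0 \<Rightarrow> {undefined} | Suc m \<Rightarrow> verts (\<Gamma> (Suc m)))" for n
  define p where "p n = (case n of 0 \<Rightarrow> (\<lambda>_. undefined) | Suc m \<Rightarrow> f m)" for n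
  define s where "s i n = (case n of 0 \<Rightarrow> id | Suc m \<Rightarrow>
    schreier_labelling.follow (\<Gamma> (Suc m)) (\<l> m) (i, True))" for i n
  have L: "L 0 = {undefined}" "L (Suc m) = verts (\<Gamma> (Suc m))" for m by (simp_all add: L_def)
  have p: "p 0 = (\<lambda>_. undefined)" "p (Suc m) = f m" for m by (simp_all add: p_def)
  have s: "s i 0 = id" "s i (Suc m) = schreier_labelling.follow (\<Gamma> (Suc m)) (\<l> m) (i, True)" for i m
    by (simp_all add: s_def)
  interpret inverse_sequence L p undefined
  proof
    show "L 0 = {undefined}" by (rule L)
    show "p n w \<in> L n" if "w \<in> L (Suc n)" for w n
    proof (cases n)
      case (Suc m)
      then show ?thesis
        using that cov[of m] by (auto simp: L p multigraph_covering_def multigraph_hom_def)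
    qed (simp add: L p)
  qed
  let ?T = level_tree and ?r = "(0::nat, undefined::'v)"
  define \<sigma>s where "\<sigma>s = map (\<lambda>i. tree_map (s i)) [0..<k]"
  have aut: "tree_map (s i) \<in> carrier (tree_Aut ?T ?r)" if i: "i < k" for i
  proof (rule tree_map_in_Aut)
    show "bij_betw (s i n) (L n) (L n)" for n
      using schreier_labelling.bij_betw_follow[OF lab i] by (cases n) (simp_all add: L s)
    show "p n (s i (Suc n) w) = s i n (p n w)" if "w \<in> L (Suc n)" for n w
    proof (cases n)
      case (Suc m)
      show ?thesis
        using follow_covering[OF bidir lab cov _ i, of w m True] that Suc
        by (simp add: L p s \<l>_Suc)
    qed (simp add: p s)
  qed
  define G where "G = generate (tree_Aut ?T ?r) (set \<sigma>s)"
  have rooted: "rooted_tree ?T ?r" by (rule rooted_level_tree)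
  have "?r \<in> pverts ?T" by (simp add: pverts_level_tree L)
  then have "Group.group (tree_Aut ?T ?r)" by (rule group_tree_Aut)
  moreover have "set \<sigma>s \<subseteq> carrier (tree_Aut ?T ?r)" using aut by (auto simp: \<sigma>s_def)
  ultimately have "subgroup G (tree_Aut ?T ?r)"
    unfolding G_def by (rule group.generate_is_subgroup)
  moreover have "set \<sigma>s \<subseteq> G" by (auto simp: G_def intro: generate.incl)
  moreover have "multigraph_isomorphic (\<Gamma> n) (\<rho> n)
      (schreier_graph (level_action ?T ?r n) (tree_level ?T ?r n) \<sigma>s)
      (schreier_rev (tree_level ?T ?r n) \<sigma>s)" if "n \<ge> 1" for n
  proof -
    obtain m where n: "n = Suc m" using \<open>n \<ge> 1\<close> by (cases n) auto
    show ?thesis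
      unfolding n tree_level_level_tree
    proof (rule schreier_labelling.isomorphic_schreier_graph[OF lab])
      show "bij_betw (Pair (Suc m)) (verts (\<Gamma> (Suc m))) ({Suc m} \<times> L (Suc m))"
        by (auto simp: bij_betw_def inj_on_def L)
      show "length \<sigma>s = k" by (simp add: \<sigma>s_def)
      fix i v assume "i < k" "v \<in> verts (\<Gamma> (Suc m))"
      then show "level_action ?T ?r (Suc m) (\<sigma>s ! i) (Suc m, v) =
          (Suc m, schreier_labelling.follow (\<Gamma> (Suc m)) (\<l> m) (i, True) v)"
        by (simp add: level_action_def tree_level_level_tree \<sigma>s_def tree_map_def L s)
    qed
  qed
  ultimately show ?thesis
    using rooted by (intro exI[of _ ?T] exI[of _ ?r] exI[of _ G] exI[of _ \<sigma>s]) (simp add: \<sigma>s_def G_def)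
qed

end
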